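(* Let $J\subset\mathcal P=k[X_0,\dots,X_n]$ be a strongly stable monomial ideal and let $I\subset\mathcal P$ be a homogeneous ideal that contains a $J$-set $G$. The following are equivalent: (1) $I\in B\mathcal St(J)$; (2) $G$ is a $J$-basis of $I$, i.e. $G$ generates $I$ and $\mathcal N(J)$ is a basis of $\mathcal P/(G)$ as a $k$-vector space; (3) $\mathcal N(J)$ is free (linearly independent over $k$) in $\mathcal P/I$; (4) $I$ and $J$ share the same Hilbert function, i.e. $\dim_k I_m=\dim_k J_m$ for all $m$; (5) $\dim_k I_m\le\dim_k J_m$ for all $m$; (6) for every $h\in I$: $h\stackrel{G^*}{\longrightarrow}_+0$; (7) for every $h\in\mathcal P$, if $h_0$ is any $J$-normal form modulo $I$ of $h$, then $h\stackrel{G^*}{\longrightarrow}_+h_0$; (8) for every monomial $X^\beta\in\mathcal P$, if $h_0$ is any $J$-normal form modulo $I$ of $X^\beta$, then $X^\beta\stackrel{G^*}{\longrightarrow}_+h_0$.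
   Context: $k$ is an algebraically closed field of any characteristic, $\mathcal P=k[X_0,\dots,X_n]$ with the variables ordered $X_0<X_1<\dots<X_n$; $X^\alpha=X_0^{\alpha_0}\cdots X_n^{\alpha_n}$. For a monomial ideal $J$, $B_J$ is its set of minimal monomial generators, $\mathcal N(J)$ is the set of monomials not in $J$; $I_m$, $J_m$ denote degree $m$ parts. Strongly stable: an up elementary move replaces a monomial $X^\delta X_i$ by $X^\delta X_j$ with $X_i<X_j$; write $X^\alpha\prec_B X^\beta$ if $X^\beta$ is obtained from $X^\alpha$ by a sequence of up elementary moves. $J$ is strongly stable if it contains every monomial $X^\alpha$ with $X^\alpha\succ_B X^\beta$ for some monomial $X^\beta\in J$. $B\mathcal St(J)$ is the family of all homogeneous ideals $I\subset\mathcal P$ such that $\mathcal N(J)$ is a basis of $\mathcal P/I$ as a $k$-vector space. $J$-set: a set $G=\{f_\alpha=X^\alpha-\sum c_{\alpha\gamma}X^\gamma \mid X^\alpha\in B_J\}$ of homogeneous polynomials, one for each $X^\alpha\in B_J$, with $c_{\alpha\gamma}\in k$ and $X^\gamma\in\mathcal N(J)$ of the same degree as $X^\alpha$. The head of $f_\alpha$ is $X^\alpha$ and its tail is $\sum c_{\alpha\gamma}X^\gamma$. A polynomial is in $J$-normal form if it is a $k$-linear combination of monomials of $\mathcal N(J)$; a $J$-normal form modulo $I$ of $h$ is a polynomial $h_0$ in $J$-normal form with $h-h_0\in I$. $G^*$-reduction (defined by recursion on degree): a step of $G^*$-reduction of a polynomial $h$ not in $J$-normal form chooses a monomial $X^\beta\in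 J$ appearing in $h$ with nonzero coefficient, of degree $m$ say, and replaces it (keeping its coefficient) as follows. If $X^\beta=X^\alpha\in B_J$, it is replaced by the tail of $f_\alpha$. If $X^\beta\notin B_J$, one writes $X^\beta=X_iX^\delta$ with $X_i$ a variable and $X^\delta\in J_{m-1}$, and replaces $X^\beta$ by $X_ig_0$, where $g_0$ is the result of a complete $G^*$-reduction of $X^\delta$. A complete $G^*$-reduction is a finite (possibly empty) sequence of such steps ending in a polynomial in $J$-normal form; $h\stackrel{G^*}{\longrightarrow}_+h_0$ means that there is a complete $G^*$-reduction of $h$ ending in $h_0$. *)

theory Defs
  imports
    "HOL-Library.Poly_Mapping"
    "HOL-Library.Set_Algebras"
    "HOL-Computational_Algebra.Polynomial"
begin

text \<open>
  The polynomial ring in \<open>CARD('x)\<close> ordered variables is the type \<open>('x, 'k) mpoly\<close> with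
  \<open>'x :: {finite, linorder}\<close>: a polynomial is a finitely supported map from exponent vectors to
  coefficients, with the convolution product. As types are nonempty, the free type \<open>'x\<close> plays the
  role of \<open>{0 < 1 < \<dots> < n}\<close> for an arbitrary \<open>n \<ge> 0\<close>. A monomial is represented by its exponent
  vector, so that the product of monomials is \<open>+\<close> on \<open>'x mon\<close>.
\<close>

type_synonym 'x mon = "'x \<Rightarrow>\<^sub>0 nat"
type_synonym ('x, 'k) mpoly = "('x \<Rightarrow>\<^sub>0 nat) \<Rightarrow>\<^sub>0 'k"

definition monomial_poly :: "'x mon \<Rightarrow> ('x, 'k::zero_neq_one) mpoly"
  where "monomial_poly \<alpha> = Poly_Mapping.single \<alpha> 1"

definition var_mon :: "'x \<Rightarrow> 'x mon"
  where "var_mon i = Poly_Mapping.single i 1"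

definition scale :: "'k \<Rightarrow> ('x, 'k::comm_semiring_1) mpoly \<Rightarrow> ('x, 'k) mpoly"
  where "scale c p = Poly_Mapping.single 0 c * p"

definition mdeg :: "'x::finite mon \<Rightarrow> nat"
  where "mdeg \<alpha> = (\<Sum>i\<in>UNIV. Poly_Mapping.lookup \<alpha> i)"

definition homogeneous :: "nat \<Rightarrow> ('x::finite, 'k::zero) mpoly \<Rightarrow> bool"
  where "homogeneous m p \<longleftrightarrow> (\<forall>\<alpha> \<in> Poly_Mapping.keys p. mdeg \<alpha> = m)"

text \<open>
  Ideals are the submodules of the ring over itself; the first interpretation provides
  \<open>ideal.subspace\<close> (being an ideal) and \<open>ideal.span\<close> (the ideal generated by a set), the
  second one \<open>k_linear.dim\<close> (dimension over \<open>k\<close>).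
\<close>

global_interpretation ideal: module "(*) :: 'r::comm_ring_1 \<Rightarrow> 'r \<Rightarrow> 'r"
  by unfold_locales (simp_all add: algebra_simps)

global_interpretation k_linear:
  vector_space "scale :: 'k::field \<Rightarrow> ('x, 'k) mpoly \<Rightarrow> ('x, 'k) mpoly"
  by unfold_locales
    (simp_all add: scale_def distrib_left distrib_right Poly_Mapping.single_add
      Poly_Mapping.mult_single flip: mult.assoc)

definition monomial_ideal :: "('x, 'k::comm_ring_1) mpoly set \<Rightarrow> bool"
  where "monomial_ideal J \<longleftrightarrow> (\<exists>A. J = ideal.span (monomial_poly ` A))"

definition homogeneous_ideal :: "('x::finite, 'k::comm_ring_1) mpoly set \<Rightarrow> bool"
  where "homogeneous_ideal I \<longleftrightarrow>
    (\<exists>H. (\<forall>h\<in>H. \<exists>m. homogeneous m h) \<and> I = ideal.span H)"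

definition degree_part :: "('x::finite, 'k::zero) mpoly set \<Rightarrow> nat \<Rightarrow> ('x, 'k) mpoly set"
  where "degree_part I m = {p \<in> I. homogeneous m p}"

definition hilbert_dim :: "('x::finite, 'k::field) mpoly set \<Rightarrow> nat \<Rightarrow> nat"
  where "hilbert_dim I m = k_linear.dim (degree_part I m)"

definition min_gens :: "('x, 'k::zero_neq_one) mpoly set \<Rightarrow> 'x mon set"
  where "min_gens J =
    {\<alpha>. monomial_poly \<alpha> \<in> J \<and> (\<forall>\<beta> \<delta>. \<alpha> = \<beta> + \<delta> \<and> monomial_poly \<beta> \<in> J \<longrightarrow> \<beta> = \<alpha>)}"

definition nonmembers :: "('x, 'k::zero_neq_one) mpoly set \<Rightarrow> 'x mon set"
  where "nonmembers J = {\<alpha>. monomial_poly \<alpha> \<notin> J}"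

definition up_move :: "'x::linorder mon \<Rightarrow> 'x mon \<Rightarrow> bool"
  where "up_move \<alpha> \<beta> \<longleftrightarrow>
    (\<exists>\<delta> i j. i < j \<and> \<alpha> = \<delta> + var_mon i \<and> \<beta> = \<delta> + var_mon j)"

definition borel_less :: "'x::linorder mon \<Rightarrow> 'x mon \<Rightarrow> bool"
  where "borel_less = up_move\<^sup>+\<^sup>+"

definition strongly_stable :: "('x::linorder, 'k::comm_ring_1) mpoly set \<Rightarrow> bool"
  where "strongly_stable J \<longleftrightarrow> monomial_ideal J \<and>
    (\<forall>\<alpha> \<beta>. monomial_poly \<beta> \<in> J \<and> borel_less \<beta> \<alpha> \<longrightarrow> monomial_poly \<alpha> \<in> J)"

text \<open>
  Residue classes modulo \<open>I\<close> are the cosets \<open>h +o I\<close>. As distinct monomials may have the same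
  class, linear independence in the quotient refers to the family of classes indexed by the
  monomials, not to the set of classes.
\<close>

definition free_mod :: "'x mon set \<Rightarrow> ('x, 'k::field) mpoly set \<Rightarrow> bool"
  where "free_mod N I \<longleftrightarrow>
    (\<forall>A c. finite A \<and> A \<subseteq> N \<and> (\<Sum>\<alpha>\<in>A. scale (c \<alpha>) (monomial_poly \<alpha>)) +o I = 0 +o I
      \<longrightarrow> (\<forall>\<alpha>\<in>A. c \<alpha> = 0))"

definition spans_mod :: "'x mon set \<Rightarrow> ('x, 'k::field) mpoly set \<Rightarrow> bool"
  where "spans_mod N I \<longleftrightarrow>
    (\<forall>h. \<exists>A c. finite A \<and> A \<subseteq> N \<and> h +o I = (\<Sum>\<alpha>\<in>A. scale (c \<alpha>) (monomial_poly \<alpha>)) +o I)"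

definition basis_mod :: "'x mon set \<Rightarrow> ('x, 'k::field) mpoly set \<Rightarrow> bool"
  where "basis_mod N I \<longleftrightarrow> free_mod N I \<and> spans_mod N I"

definition BSt :: "('x::finite, 'k::field) mpoly set \<Rightarrow> ('x, 'k) mpoly set set"
  where "BSt J = {I. homogeneous_ideal I \<and> basis_mod (nonmembers J) I}"

definition normal_form :: "('x, 'k::field) mpoly set \<Rightarrow> ('x, 'k) mpoly \<Rightarrow> bool"
  where "normal_form J h \<longleftrightarrow> Poly_Mapping.keys h \<subseteq> nonmembers J"

definition normal_form_mod ::
    "('x, 'k::field) mpoly set \<Rightarrow> ('x, 'k) mpoly set \<Rightarrow> ('x, 'k) mpoly \<Rightarrow> ('x, 'k) mpoly \<Rightarrow> bool"
  where "normal_form_mod J I h h0 \<longleftrightarrow> normal_form J h0 \<and> h - h0 \<in> I"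

text \<open>
  A \<open>J\<close>-set is the family \<open>f\<close> of its elements indexed by their heads; only the values of \<open>f\<close> on
  \<open>min_gens J\<close> matter.
\<close>

definition tail :: "('x mon \<Rightarrow> ('x, 'k::field) mpoly) \<Rightarrow> 'x mon \<Rightarrow> ('x, 'k) mpoly"
  where "tail f \<alpha> = monomial_poly \<alpha> - f \<alpha>"

definition J_set ::
    "('x::finite, 'k::field) mpoly set \<Rightarrow> ('x mon \<Rightarrow> ('x, 'k) mpoly) \<Rightarrow> bool"
  where "J_set J f \<longleftrightarrow>
    (\<forall>\<alpha>\<in>min_gens J. normal_form J (tail f \<alpha>) \<and> homogeneous (mdeg \<alpha>) (tail f \<alpha>))"

definition J_basis ::
    "('x, 'k::field) mpoly set \<Rightarrow> ('x, 'k) mpoly set \<Rightarrow> ('x, 'k) mpoly set \<Rightarrow> bool"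
  where "J_basis J G I \<longleftrightarrow>
    ideal.span G = I \<and> basis_mod (nonmembers J) (ideal.span G)"

text \<open>
  The recursion on the degree in the definition of \<open>G\<^sup>*\<close>-reduction is rendered by a mutual
  inductive definition: a step at a monomial of degree \<open>m\<close> refers to complete reductions of
  monomials of degree \<open>m - 1\<close> only, and those involve only monomials of that degree because the
  tails are homogeneous.
\<close>

inductive G_step :: "('x, 'k::field) mpoly set \<Rightarrow> ('x mon \<Rightarrow> ('x, 'k) mpoly)
      \<Rightarrow> ('x, 'k) mpoly \<Rightarrow> ('x, 'k) mpoly \<Rightarrow> bool"
  and G_reduces :: "('x, 'k::field) mpoly set \<Rightarrow> ('x mon \<Rightarrow> ('x, 'k) mpoly)
      \<Rightarrow> ('x, 'k) mpoly \<Rightarrow> ('x, 'k) mpoly \<Rightarrow> bool"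
  for J :: "('x, 'k::field) mpoly set" and f :: "'x mon \<Rightarrow> ('x, 'k) mpoly"
where
  generator:
    "\<lbrakk>\<beta> \<in> Poly_Mapping.keys h; \<beta> \<in> min_gens J\<rbrakk> \<Longrightarrow>
      G_step J f h (h - scale (Poly_Mapping.lookup h \<beta>) (monomial_poly \<beta>)
                      + scale (Poly_Mapping.lookup h \<beta>) (tail f \<beta>))"
| multiple:
    "\<lbrakk>\<beta> \<in> Poly_Mapping.keys h; \<beta> \<notin> min_gens J; \<beta> = var_mon i + \<delta>; monomial_poly \<delta> \<in> J;
      G_reduces J f (monomial_poly \<delta>) g0\<rbrakk> \<Longrightarrow>
      G_step J f h (h - scale (Poly_Mapping.lookup h \<beta>) (monomial_poly \<beta>)
                      + scale (Poly_Mapping.lookup h \<beta>) (monomial_poly (var_mon i) * g0))"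
| finished: "normal_form J h \<Longrightarrow> G_reduces J f h h"
| prepend: "\<lbrakk>G_step J f h h'; G_reduces J f h' h0\<rbrakk> \<Longrightarrow> G_reduces J f h h0"

end

theory Submission
  imports Defs
begin

text \<open>
  Every polynomial has a complete \<open>G\<^sup>*\<close>-reduction: strong stability allows a monomial of \<open>J\<close> that is
  not a generator to be reduced through its smallest variable, and this leaves only monomials of
  \<open>J\<close> of the same degree that are generators or have a smaller smallest variable. Reductions stay
  within a residue class modulo every ideal containing \<open>G\<close>, so \<open>\<N>(J)\<close> always spans the quotient,
  and each of the conditions amounts to \<open>I\<close> containing no nonzero normal form. For the Hilbert
  functions one compares, in degree \<open>m\<close>, a basis of \<open>I\<^sub>m\<close> together with the monomials outside \<open>J\<close>
  with the set of all monomials.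
\<close>

section \<open>Polynomials and their homogeneous parts\<close>

lemma lookup_scale [simp]:
  "Poly_Mapping.lookup (scale c p) \<alpha> = c * Poly_Mapping.lookup p \<alpha>"
  unfolding scale_def mult_map_scale_conv_mult[symmetric]
  by (simp add: Poly_Mapping.map.rep_eq when_def)

lemma lookup_monomial_poly [simp]:
  "Poly_Mapping.lookup (monomial_poly \<alpha>) \<beta> = (if \<alpha> = \<beta> then 1 else 0)"
  by (simp add: monomial_poly_def lookup_single when_def)

lemma keys_monomial_poly [simp]: "Poly_Mapping.keys (monomial_poly \<alpha>) = {\<alpha>}"
  by (simp add: monomial_poly_def)

lemma monomial_poly_add:
  "(monomial_poly (\<alpha> + \<beta>) :: ('x, 'k::comm_semiring_1) mpoly) = monomial_poly \<alpha> * monomial_poly \<beta>"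
  by (simp add: monomial_poly_def mult_single)

lemma mdeg_add: "mdeg (\<alpha> + \<beta>) = mdeg \<alpha> + mdeg \<beta>"
  by (simp add: mdeg_def lookup_add sum.distrib)

lemma mdeg_var_mon [simp]: "mdeg (var_mon i) = 1"
  by (simp add: mdeg_def var_mon_def lookup_single when_def)

lemma finite_mdeg_eq: "finite {\<alpha> :: 'x::finite mon. mdeg \<alpha> = m}"
proof -
  have "Poly_Mapping.lookup ` {\<alpha> :: 'x mon. mdeg \<alpha> = m} \<subseteq> {g. \<forall>i. g i \<in> {..m}}"
    by (auto simp: mdeg_def intro: member_le_sum)
  moreover have "finite {g :: 'x \<Rightarrow> nat. \<forall>i. (i \<in> UNIV \<longrightarrow> g i \<in> {..m}) \<and> (i \<notin> UNIV \<longrightarrow> g i = 0)}"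
    by (intro finite_set_of_finite_funs) auto
  ultimately have "finite (Poly_Mapping.lookup ` {\<alpha> :: 'x mon. mdeg \<alpha> = m})"
    by (auto intro: finite_subset)
  then show ?thesis
    by (rule finite_imageD) (simp add: inj_on_def)
qed

text \<open>The coordinate projection onto the span of the monomials in \<open>S\<close>. With all
  monomials of degree m it is the homogeneous component; with the monomials of \<open>J\<close> of
  degree m it serves to compare dimensions in \<open>I\<close> and \<open>J\<close>.\<close>

definition part :: "'x mon set \<Rightarrow> ('x, 'k::zero) mpoly \<Rightarrow> ('x, 'k) mpoly"
  where "part S = Poly_Mapping.mapp (\<lambda>\<alpha> c. if \<alpha> \<in> S then c else 0)"

lemma lookup_part [simp]:
  "Poly_Mapping.lookup (part S p) \<alpha> = (if \<alpha> \<in> S then Poly_Mapping.lookup p \<alpha> else 0)"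
  by (auto simp: part_def lookup_mapp when_def in_keys_iff)

lemma keys_part [simp]: "Poly_Mapping.keys (part S p) = Poly_Mapping.keys p \<inter> S"
  by (auto simp: in_keys_iff split: if_splits)

lemma part_zero [simp]: "part S 0 = 0"
  by (rule poly_mapping_eqI) simp

lemma part_add: "part S (p + q) = part S p + part S q"
  by (rule poly_mapping_eqI) (simp add: lookup_add)

lemma part_diff:
  "part S (p - q) = part S p - part S (q :: ('x, 'k::ab_group_add) mpoly)"
  by (rule poly_mapping_eqI) (simp add: lookup_minus)

lemma part_scale: "part S (scale c p) = scale c (part S p)"
  by (rule poly_mapping_eqI) simp

lemma part_id: "Poly_Mapping.keys p \<subseteq> S \<Longrightarrow> part S p = p"
  by (rule poly_mapping_eqI) (auto simp: in_keys_iff)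

lemma part_eq_0: "Poly_Mapping.keys p \<inter> S = {} \<Longrightarrow> part S p = 0"
  by (rule poly_mapping_eqI) (auto simp: in_keys_iff)

lemma linear_part: "Vector_Spaces.linear scale scale (part S :: ('x, 'k::field) mpoly \<Rightarrow> _)"
  by unfold_locales (simp_all add: part_add part_scale)

section \<open>Linear algebra over the basis of monomials\<close>

lemma poly_eq_sum_keys:
  "p = (\<Sum>\<alpha>\<in>Poly_Mapping.keys p. scale (Poly_Mapping.lookup p \<alpha>) (monomial_poly \<alpha>))"
  by (rule poly_mapping_eqI) (simp add: lookup_sum if_distrib in_keys_iff cong: if_cong)

lemma lookup_sum_scale_monomial_poly:
  assumes "finite A"
  shows "Poly_Mapping.lookup (\<Sum>\<alpha>\<in>A. scale (c \<alpha>) (monomial_poly \<alpha>)) \<beta> = (if \<beta> \<in> A then c \<beta> else 0)"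
  using assms by (simp add: lookup_sum if_distrib cong: if_cong)

lemma inj_monomial_poly: "inj (monomial_poly :: 'x mon \<Rightarrow> ('x, 'k::zero_neq_one) mpoly)"
  by (metis injI keys_monomial_poly singleton_inject)

lemma in_span_monomial_polys_iff:
  "(p :: ('x, 'k::field) mpoly) \<in> k_linear.span (monomial_poly ` A) \<longleftrightarrow> Poly_Mapping.keys p \<subseteq> A"
proof
  assume "p \<in> k_linear.span (monomial_poly ` A)"
  then show "Poly_Mapping.keys p \<subseteq> A"
  proof (induction rule: k_linear.span_induct_alt)
    case (step c x y)
    then show ?case
      by (auto simp: in_keys_iff lookup_add split: if_splits)
  qed simp
next
  assume "Poly_Mapping.keys p \<subseteq> A"
  then show "p \<in> k_linear.span (monomial_poly ` A)"
    by (subst poly_eq_sum_keys) (intro k_linear.span_sum k_linear.span_scale k_linear.span_base, auto)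
qed

lemma independent_monomial_polys:
  "k_linear.independent (monomial_poly ` A :: ('x, 'k::field) mpoly set)"
proof
  assume "k_linear.dependent (monomial_poly ` A :: ('x, 'k) mpoly set)"
  then obtain \<alpha> where "\<alpha> \<in> A"
    and "(monomial_poly \<alpha> :: ('x, 'k) mpoly) \<in> k_linear.span (monomial_poly ` A - {monomial_poly \<alpha>})"
    by (auto simp: k_linear.dependent_def)
  moreover have "monomial_poly ` A - {monomial_poly \<alpha> :: ('x, 'k) mpoly} \<subseteq> monomial_poly ` (A - {\<alpha>})"
    by auto
  ultimately have "(monomial_poly \<alpha> :: ('x, 'k) mpoly) \<in> k_linear.span (monomial_poly ` (A - {\<alpha>}))"
    using k_linear.span_mono by blast
  then show False
    by (simp add: in_span_monomial_polys_iff)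
qed

lemma card_monomial_polys: "card (monomial_poly ` A :: ('x, 'k::zero_neq_one) mpoly set) = card A"
  by (intro card_image inj_on_subset[OF inj_monomial_poly]) simp

lemma ideal_scale:
  assumes "ideal.subspace I" "p \<in> I"
  shows "scale c p \<in> I"
  unfolding scale_def using assms by (rule ideal.subspace_scale)

lemma homogeneous_part: "homogeneous m (part {\<alpha>. mdeg \<alpha> = m} p)"
  by (auto simp: homogeneous_def)

text \<open>The definition only provides homogeneous generators. Taking a component is k-linear, so
  it is enough to treat a term times a generator, which is homogeneous and therefore kept or killed
  as a whole.\<close>

lemma homogeneous_ideal_part:
  fixes I :: "('x::finite, 'k::field) mpoly set"
  assumes "homogeneous_ideal I" "p \<in> I"
  shows "part {\<alpha>. mdeg \<alpha> = m} p \<in> I"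
proof -
  let ?D = "{\<alpha> :: 'x mon. mdeg \<alpha> = m}"
  obtain H where H: "\<And>h. h \<in> H \<Longrightarrow> \<exists>d. homogeneous d h" and I: "I = ideal.span H"
    using assms(1) by (auto simp: homogeneous_ideal_def)
  have monomial_multiple: "part ?D (scale a (monomial_poly \<alpha> * h)) \<in> I" if "h \<in> H" for a \<alpha> h
  proof -
    obtain d where "homogeneous d h"
      using H \<open>h \<in> H\<close> by blast
    then have deg: "mdeg \<gamma> = mdeg \<alpha> + d" if "\<gamma> \<in> Poly_Mapping.keys (monomial_poly \<alpha> * h)" for \<gamma>
      using that keys_mult[of "monomial_poly \<alpha>" h] by (auto simp: homogeneous_def mdeg_add)
    have "monomial_poly \<alpha> * h \<in> I"
      using \<open>h \<in> H\<close> by (simp add: I ideal.span_base ideal.span_scale)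
    moreover have "part ?D (monomial_poly \<alpha> * h) \<in> {0, monomial_poly \<alpha> * h}"
      using deg by (cases "m = mdeg \<alpha> + d") (auto intro!: part_id part_eq_0)
    ultimately have "part ?D (monomial_poly \<alpha> * h) \<in> I"
      by (auto simp: I ideal.span_zero)
    then show ?thesis
      by (simp add: part_scale I ideal_scale)
  qed
  show ?thesis
    using assms(2) unfolding I
  proof (induction rule: ideal.span_induct_alt)
    case base
    then show ?case by (simp add: ideal.span_zero)
  next
    case (step c h y)
    \<comment> \<open>The coefficient \<open>c\<close> is an arbitrary polynomial. It is split into
      terms because the projection commutes with scalars but not with multiplication by
      polynomials.\<close>
    have "c * h = (\<Sum>\<alpha>\<in>Poly_Mapping.keys c. scale (Poly_Mapping.lookup c \<alpha>) (monomial_poly \<alpha>)) * h"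
      by (rule arg_cong[OF poly_eq_sum_keys])
    also have "\<dots> = (\<Sum>\<alpha>\<in>Poly_Mapping.keys c. scale (Poly_Mapping.lookup c \<alpha>) (monomial_poly \<alpha> * h))"
      by (simp only: sum_distrib_right scale_def mult.assoc)
    finally have "part ?D (c * h) =
        (\<Sum>\<alpha>\<in>Poly_Mapping.keys c. part ?D (scale (Poly_Mapping.lookup c \<alpha>) (monomial_poly \<alpha> * h)))"
      using module_hom.sum[OF linear_part[unfolded linear_iff_module_hom]] by simp
    also have "\<dots> \<in> ideal.span H"
      using monomial_multiple step.hyps by (intro ideal.span_sum) (simp add: I)
    finally show ?case
      using step.IH by (simp add: part_add ideal.span_add)
  qed
qed

section \<open>Monomial ideals and bases of the quotient\<close>

lemma monomial_ideal_subspace: "monomial_ideal J \<Longrightarrow> ideal.subspace J"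
  by (auto simp: monomial_ideal_def)

lemma homogeneous_ideal_subspace: "homogeneous_ideal I \<Longrightarrow> ideal.subspace I"
  by (auto simp: homogeneous_ideal_def)

lemma monomial_poly_add_in_ideal:
  assumes "ideal.subspace J" "monomial_poly \<alpha> \<in> J"
  shows "monomial_poly (\<alpha> + \<beta>) \<in> J" "monomial_poly (\<beta> + \<alpha>) \<in> J"
proof -
  show "monomial_poly (\<beta> + \<alpha>) \<in> J"
    unfolding monomial_poly_add using assms by (rule ideal.subspace_scale)
  then show "monomial_poly (\<alpha> + \<beta>) \<in> J"
    by (simp add: add.commute)
qed

text \<open>All monomials of a multiple of a generator are divisible by that generator, and a
  polynomial is a k-combination of its own monomials.\<close>

lemma in_monomial_ideal_iff:
  fixes J :: "('x, 'k::field) mpoly set"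
  assumes "monomial_ideal J"
  shows "p \<in> J \<longleftrightarrow> Poly_Mapping.keys p \<subseteq> {\<alpha>. monomial_poly \<alpha> \<in> J}"
proof
  obtain A where J: "J = ideal.span (monomial_poly ` A)"
    using assms by (auto simp: monomial_ideal_def)
  assume "p \<in> J"
  then show "Poly_Mapping.keys p \<subseteq> {\<alpha>. monomial_poly \<alpha> \<in> J}"
    unfolding J
  proof (induction rule: ideal.span_induct_alt)
    case (step c h y)
    then obtain \<alpha> where "\<alpha> \<in> A" "h = monomial_poly \<alpha>"
      by blast
    then have "monomial_poly \<gamma> \<in> J" if "\<gamma> \<in> Poly_Mapping.keys (c * h)" for \<gamma>
      using that keys_mult[of c h]
      by (auto simp: J ideal.span_base intro!: monomial_poly_add_in_ideal)
    then show ?case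
      using step.IH keys_add[of "c * h" y] J by blast
  qed simp
next
  assume "Poly_Mapping.keys p \<subseteq> {\<alpha>. monomial_poly \<alpha> \<in> J}"
  then show "p \<in> J"
    using monomial_ideal_subspace[OF assms]
    by (subst poly_eq_sum_keys) (auto intro!: ideal.subspace_sum ideal_scale)
qed

section \<open>Residue classes and independence in the quotient\<close>

lemma coset_eq_iff:
  assumes "ideal.subspace I"
  shows "p +o I = q +o I \<longleftrightarrow> p - q \<in> I"
proof
  assume "p +o I = q +o I"
  moreover have "p \<in> p +o I"
    using ideal.subspace_0[OF assms] by (force simp: elt_set_plus_def)
  ultimately show "p - q \<in> I"
    by (auto simp: elt_set_plus_def)
next
  have "p +o I \<subseteq> q +o I" if "p - q \<in> I" for p q
  proof
    fix r
    assume "r \<in> p +o I"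
    then obtain i where "i \<in> I" "r = q + (p - q + i)"
      by (auto simp: elt_set_plus_def)
    then show "r \<in> q +o I"
      using ideal.subspace_add[OF assms that] unfolding elt_set_plus_def by blast
  qed
  moreover assume "p - q \<in> I"
  moreover from this have "q - p \<in> I"
    using ideal.subspace_neg[OF assms] by fastforce
  ultimately show "p +o I = q +o I"
    by blast
qed

text \<open>The scalars in a combination of distinct monomials can be read off as coefficients of
  the resulting polynomial, so a relation among the classes is the same thing as an element of
  \<open>I\<close> supported on \<open>N\<close>.\<close>

lemma free_mod_iff:
  fixes I :: "('x, 'k::field) mpoly set"
  assumes "ideal.subspace I"
  shows "free_mod N I \<longleftrightarrow> (\<forall>p\<in>I. Poly_Mapping.keys p \<subseteq> N \<longrightarrow> p = 0)"
proof (intro iffI ballI impI)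
  fix p
  assume free: "free_mod N I" and p: "p \<in> I" "Poly_Mapping.keys p \<subseteq> N"
  have "\<forall>\<alpha>\<in>Poly_Mapping.keys p. Poly_Mapping.lookup p \<alpha> = 0"
    using p free[unfolded free_mod_def coset_eq_iff[OF assms], THEN spec, THEN spec,
        of "Poly_Mapping.keys p" "Poly_Mapping.lookup p"]
    by (simp flip: poly_eq_sum_keys)
  then show "p = 0"
    by (metis in_keys_iff keys_eq_empty all_not_in_conv)
next
  assume *: "\<forall>p\<in>I. Poly_Mapping.keys p \<subseteq> N \<longrightarrow> p = 0"
  show "free_mod N I"
    unfolding free_mod_def coset_eq_iff[OF assms]
  proof (intro allI impI ballI)
    fix A and c :: "'x mon \<Rightarrow> 'k" and \<alpha>
    let ?p = "\<Sum>\<alpha>\<in>A. scale (c \<alpha>) (monomial_poly \<alpha>)"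
    assume A: "finite A \<and> A \<subseteq> N \<and> ?p - 0 \<in> I" and \<alpha>: "\<alpha> \<in> A"
    then have lookup: "Poly_Mapping.lookup ?p \<beta> = (if \<beta> \<in> A then c \<beta> else 0)" for \<beta>
      by (intro lookup_sum_scale_monomial_poly) simp
    then have "Poly_Mapping.keys ?p \<subseteq> N"
      using A by (auto simp: in_keys_iff simp del: lookup_scale lookup_monomial_poly split: if_splits)
    then have "?p = 0"
      using * A by simp
    then show "c \<alpha> = 0"
      using lookup[of \<alpha>] \<alpha> by simp
  qed
qed

lemma spans_modI:
  fixes I :: "('x, 'k::field) mpoly set"
  assumes "ideal.subspace I" "\<And>h. \<exists>h0. Poly_Mapping.keys h0 \<subseteq> N \<and> h - h0 \<in> I"
  shows "spans_mod N I"
  unfolding spans_mod_def coset_eq_iff[OF assms(1)]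
proof
  fix h
  obtain h0 where "Poly_Mapping.keys h0 \<subseteq> N" "h - h0 \<in> I"
    using assms(2) by blast
  then show "\<exists>A c. finite A \<and> A \<subseteq> N \<and> h - (\<Sum>\<alpha>\<in>A. scale (c \<alpha>) (monomial_poly \<alpha>)) \<in> I"
    by (intro exI[of _ "Poly_Mapping.keys h0"] exI[of _ "Poly_Mapping.lookup h0"])
      (simp flip: poly_eq_sum_keys)
qed

section \<open>Existence of complete reductions\<close>

lemma var_mon_add_if_in_keys:
  assumes "i \<in> Poly_Mapping.keys \<alpha>"
  obtains \<gamma> where "\<alpha> = var_mon i + \<gamma>"
proof
  show "\<alpha> = var_mon i + (\<alpha> - var_mon i)"
    using assms
    by (intro poly_mapping_eqI)
      (auto simp: var_mon_def lookup_add lookup_minus lookup_single when_def in_keys_iff)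
qed

section \<open>Reduction through the smallest variable\<close>

locale marked_family =
  fixes J :: "('x::{finite,linorder}, 'k::field) mpoly set"
    and f :: "'x mon \<Rightarrow> ('x, 'k) mpoly"
  assumes strongly_stable: "strongly_stable J"
    and J_set: "J_set J f"
begin

lemma monomial_ideal: "monomial_ideal J"
  using strongly_stable by (simp add: strongly_stable_def)

lemma subspace_J: "ideal.subspace J"
  using monomial_ideal by (rule monomial_ideal_subspace)

lemma normal_form_zero: "normal_form J 0"
  by (simp add: normal_form_def)

lemma normal_form_diff: "normal_form J p \<Longrightarrow> normal_form J q \<Longrightarrow> normal_form J (p - q)"
  using keys_diff[of p q] by (auto simp: normal_form_def)

text \<open>Write the monomial as a proper multiple of some \<gamma> in \<open>J\<close> with
  cofactor \<eta>. If the smallest variable divides \<eta>, cancel it there. Otherwise it divides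
  \<gamma>, and exchanging it for a larger variable taken from \<eta> is an up move, which stays in
  \<open>J\<close>.\<close>

lemma Min_var_quotient_in_J:
  assumes "monomial_poly \<beta> \<in> J" "\<beta> \<notin> min_gens J"
  obtains \<delta> where "\<beta> = var_mon (Min (Poly_Mapping.keys \<beta>)) + \<delta>" "monomial_poly \<delta> \<in> J"
proof -
  define i where "i = Min (Poly_Mapping.keys \<beta>)"
  obtain \<gamma> \<eta> where \<beta>: "\<beta> = \<gamma> + \<eta>" and \<gamma>: "monomial_poly \<gamma> \<in> J" and "\<gamma> \<noteq> \<beta>"
    using assms by (auto simp: min_gens_def)
  then have "Poly_Mapping.keys \<eta> \<noteq> {}"
    by auto
  then obtain j where j: "j \<in> Poly_Mapping.keys \<eta>"
    by blast
  have keys_\<beta>: "Poly_Mapping.keys \<beta> = Poly_Mapping.keys \<gamma> \<union> Poly_Mapping.keys \<eta>"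
    by (auto simp: \<beta> in_keys_iff lookup_add)
  then have "j \<in> Poly_Mapping.keys \<beta>"
    using j by blast
  then have "i \<in> Poly_Mapping.keys \<beta>" and "i \<le> j"
    by (auto simp: i_def intro: Min_in)
  consider (right) "i \<in> Poly_Mapping.keys \<eta>"
    | (left) "i \<in> Poly_Mapping.keys \<gamma>" "i \<notin> Poly_Mapping.keys \<eta>"
    using \<open>i \<in> _\<close> keys_\<beta> by blast
  then have "\<exists>\<delta>. \<beta> = var_mon i + \<delta> \<and> monomial_poly \<delta> \<in> J"
  proof cases
    case right
    then obtain \<eta>' where \<eta>': "\<eta> = var_mon i + \<eta>'"
      by (rule var_mon_add_if_in_keys)
    have "\<beta> = var_mon i + (\<gamma> + \<eta>')"
      by (simp add: \<beta> \<eta>' ac_simps)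
    then show ?thesis
      using monomial_poly_add_in_ideal(1)[OF subspace_J \<gamma>] by blast
  next
    case left
    then have "i < j"
      using j \<open>i \<le> j\<close> by (metis order_le_less)
    obtain \<gamma>' where \<gamma>': "\<gamma> = var_mon i + \<gamma>'"
      using left(1) by (rule var_mon_add_if_in_keys)
    obtain \<eta>' where \<eta>': "\<eta> = var_mon j + \<eta>'"
      using j by (rule var_mon_add_if_in_keys)
    have "up_move \<gamma> (\<gamma>' + var_mon j)"
      unfolding up_move_def using \<open>i < j\<close> \<gamma>' add.commute by blast
    then have "monomial_poly (\<gamma>' + var_mon j) \<in> J"
      using strongly_stable \<gamma> by (auto simp: strongly_stable_def borel_less_def)
    then have "monomial_poly (\<gamma>' + var_mon j + \<eta>') \<in> J"
      by (rule monomial_poly_add_in_ideal(1)[OF subspace_J])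
    moreover have "\<beta> = var_mon i + (\<gamma>' + var_mon j + \<eta>')"
      by (simp add: \<beta> \<gamma>' \<eta>' ac_simps)
    ultimately show ?thesis
      by blast
  qed
  then show ?thesis
    using that unfolding i_def by blast
qed

text \<open>The termination measure within one degree. Generators come lowest, since their tails
  contain no monomial of \<open>J\<close>; \<open>Suc\<close> keeps all others strictly above them,
  ordered by the smallest variable.\<close>

definition rank :: "'x mon \<Rightarrow> nat"
  where "rank \<beta> = (if \<beta> \<in> min_gens J then 0 else Suc (card {..<Min (Poly_Mapping.keys \<beta>)}))"

text \<open>
  Reducing \<open>X\<^sup>\<beta>\<close> through its smallest variable \<open>X\<^sub>i\<close> yields multiples \<open>X\<^sub>i X\<^sup>\<gamma>\<close> with
  \<open>X\<^sup>\<gamma> \<notin> J\<close>. If such a multiple lies in \<open>J\<close> but is not a generator, then its smallest variable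
  cannot be \<open>X\<^sub>i\<close>, as dividing by the smallest variable stays in \<open>J\<close>.
\<close>

lemma rank_less:
  assumes "\<beta> \<notin> min_gens J" "i = Min (Poly_Mapping.keys \<beta>)"
    and "monomial_poly \<gamma> \<notin> J" "monomial_poly (var_mon i + \<gamma>) \<in> J"
  shows "rank (var_mon i + \<gamma>) < rank \<beta>"
proof (cases "var_mon i + \<gamma> \<in> min_gens J")
  case True
  then show ?thesis
    using assms(1) by (simp add: rank_def)
next
  case False
  let ?j = "Min (Poly_Mapping.keys (var_mon i + \<gamma>))"
  obtain \<delta> where \<delta>: "var_mon i + \<gamma> = var_mon ?j + \<delta>" "monomial_poly \<delta> \<in> J"
    using assms(4) False by (rule Min_var_quotient_in_J)
  have "i \<in> Poly_Mapping.keys (var_mon i + \<gamma>)"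
    by (simp add: in_keys_iff lookup_add var_mon_def)
  then have "?j \<le> i"
    by simp
  moreover have "?j \<noteq> i"
    using \<delta> assms(3) by auto
  ultimately have "{..<?j} \<subset> {..<i}"
    by (auto simp: psubset_eq)
  then show ?thesis
    using False assms(1,2) by (simp add: rank_def psubset_card_mono)
qed

text \<open>Puts both kinds of step into one form: a replacement \<open>r\<close> that depends on
  \<beta> alone and brings in only monomials of \<open>J\<close> of lower rank. \<open>IH\<close>
  supplies the complete reduction of the quotient, whose degree is smaller.\<close>

lemma replacement_exists:
  assumes IH: "\<And>h. \<lbrakk>\<And>\<alpha>. \<alpha> \<in> Poly_Mapping.keys h \<Longrightarrow> mdeg \<alpha> < m\<rbrakk> \<Longrightarrow>
      \<exists>h0. G_reduces J f h h0 \<and> normal_form J h0 \<and> (\<forall>\<alpha>\<in>Poly_Mapping.keys h0. mdeg \<alpha> < m)"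
    and \<beta>: "monomial_poly \<beta> \<in> J" "mdeg \<beta> \<le> m"
  obtains r where
    "\<And>h. \<beta> \<in> Poly_Mapping.keys h \<Longrightarrow> G_step J f h
      (h - scale (Poly_Mapping.lookup h \<beta>) (monomial_poly \<beta>) + scale (Poly_Mapping.lookup h \<beta>) r)"
    "\<And>\<gamma>. \<gamma> \<in> Poly_Mapping.keys r \<Longrightarrow> mdeg \<gamma> \<le> m"
    "\<And>\<gamma>. \<gamma> \<in> Poly_Mapping.keys r \<Longrightarrow> monomial_poly \<gamma> \<in> J \<Longrightarrow> rank \<gamma> < rank \<beta>"
proof (cases "\<beta> \<in> min_gens J")
  case True
  then have "normal_form J (tail f \<beta>)" "homogeneous (mdeg \<beta>) (tail f \<beta>)"
    using J_set by (auto simp: J_set_def)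
  then show ?thesis
    using True \<beta>(2)
    by (intro that[of "tail f \<beta>"] G_step_G_reduces.generator)
      (auto simp: normal_form_def homogeneous_def nonmembers_def)
next
  case False
  \<comment> \<open>A step may use any variable with quotient in \<open>J\<close>; the smallest one
    is chosen so that \<open>rank_less\<close> applies.\<close>
  let ?i = "Min (Poly_Mapping.keys \<beta>)"
  obtain \<delta> where \<delta>: "\<beta> = var_mon ?i + \<delta>" "monomial_poly \<delta> \<in> J"
    using \<beta>(1) False by (rule Min_var_quotient_in_J)
  then have "mdeg \<delta> < m"
    using \<beta>(2) mdeg_add[of "var_mon ?i" \<delta>] by simp
  then obtain g0 where g0: "G_reduces J f (monomial_poly \<delta>) g0" "normal_form J g0"
    "\<forall>\<alpha>\<in>Poly_Mapping.keys g0. mdeg \<alpha> < m"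
    using IH[of "monomial_poly \<delta>"] by auto
  have keys: "\<exists>\<gamma>'\<in>Poly_Mapping.keys g0. \<gamma> = var_mon ?i + \<gamma>'"
    if "\<gamma> \<in> Poly_Mapping.keys (monomial_poly (var_mon ?i) * g0)" for \<gamma>
    using that keys_mult[of "monomial_poly (var_mon ?i)" g0] by auto
  show ?thesis
  proof (rule that[of "monomial_poly (var_mon ?i) * g0"])
    show "G_step J f h (h - scale (Poly_Mapping.lookup h \<beta>) (monomial_poly \<beta>)
        + scale (Poly_Mapping.lookup h \<beta>) (monomial_poly (var_mon ?i) * g0))"
      if "\<beta> \<in> Poly_Mapping.keys h" for h
      using that False \<delta> g0(1) by (rule G_step_G_reduces.multiple)
    fix \<gamma>
    assume "\<gamma> \<in> Poly_Mapping.keys (monomial_poly (var_mon ?i) * g0)"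
    then obtain \<gamma>' where \<gamma>': "\<gamma>' \<in> Poly_Mapping.keys g0" "\<gamma> = var_mon ?i + \<gamma>'"
      using keys by blast
    then show "mdeg \<gamma> \<le> m"
      using g0(3) by (simp add: mdeg_add Suc_le_eq)
    show "rank \<gamma> < rank \<beta>" if "monomial_poly \<gamma> \<in> J"
      using \<gamma>' g0(2) that unfolding \<gamma>'(2)
      by (intro rank_less False) (auto simp: normal_form_def nonmembers_def)
  qed
qed

lemma reduction_exists_rank_bounded:
  assumes "\<And>\<beta>. \<lbrakk>monomial_poly \<beta> \<in> J; mdeg \<beta> \<le> m\<rbrakk> \<Longrightarrow> \<exists>r.
      (\<forall>h. \<beta> \<in> Poly_Mapping.keys h \<longrightarrow> G_step J f h
        (h - scale (Poly_Mapping.lookup h \<beta>) (monomial_poly \<beta>) + scale (Poly_Mapping.lookup h \<beta>) r)) \<and>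
      (\<forall>\<gamma>\<in>Poly_Mapping.keys r. mdeg \<gamma> \<le> m \<and> (monomial_poly \<gamma> \<in> J \<longrightarrow> rank \<gamma> < rank \<beta>))"
    and "\<And>\<alpha>. \<alpha> \<in> Poly_Mapping.keys h \<Longrightarrow> mdeg \<alpha> \<le> m"
    and "\<And>\<alpha>. \<alpha> \<in> Poly_Mapping.keys h \<Longrightarrow> monomial_poly \<alpha> \<in> J \<Longrightarrow> rank \<alpha> < n"
  shows "\<exists>h0. G_reduces J f h h0 \<and> normal_form J h0 \<and> (\<forall>\<alpha>\<in>Poly_Mapping.keys h0. mdeg \<alpha> \<le> m)"
  using assms(2,3)
proof (induction n arbitrary: h)
  case 0
  then have "normal_form J h"
    by (auto simp: normal_form_def nonmembers_def)
  then show ?case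
    using 0 G_step_G_reduces.finished by blast
next
  case (Suc n)
  show ?case
    using Suc.prems
  proof (induction "card {\<alpha> \<in> Poly_Mapping.keys h. monomial_poly \<alpha> \<in> J \<and> rank \<alpha> = n}"
      arbitrary: h rule: less_induct)
    case less
    let ?top = "\<lambda>h. {\<alpha> \<in> Poly_Mapping.keys h. monomial_poly \<alpha> \<in> J \<and> rank \<alpha> = n}"
    show ?case
    proof (cases "?top h = {}")
      case True
      \<comment> \<open>With no monomial of rank \<open>n\<close> left, the bound drops from
        \<open>Suc n\<close> to \<open>n\<close>.\<close>
      then show ?thesis
        using less.prems by (intro Suc.IH) (auto simp: less_Suc_eq)
    next
      case False
      then obtain \<beta> where \<beta>: "\<beta> \<in> ?top h"
        by blast
      then obtain r where
        step: "\<And>h. \<beta> \<in> Poly_Mapping.keys h \<Longrightarrow> G_step J f h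
          (h - scale (Poly_Mapping.lookup h \<beta>) (monomial_poly \<beta>) + scale (Poly_Mapping.lookup h \<beta>) r)"
        and r: "\<And>\<gamma>. \<gamma> \<in> Poly_Mapping.keys r \<Longrightarrow>
          mdeg \<gamma> \<le> m \<and> (monomial_poly \<gamma> \<in> J \<longrightarrow> rank \<gamma> < rank \<beta>)"
        using assms(1)[of \<beta>] less.prems(1) by blast
      define h' where
        "h' = h - scale (Poly_Mapping.lookup h \<beta>) (monomial_poly \<beta>) + scale (Poly_Mapping.lookup h \<beta>) r"
      have keys_h': "Poly_Mapping.keys h' \<subseteq> (Poly_Mapping.keys h - {\<beta>}) \<union> Poly_Mapping.keys r"
        by (auto simp: h'_def in_keys_iff lookup_add lookup_minus split: if_splits)
      have "?top h' \<subset> ?top h"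
        using \<beta> keys_h' r by fastforce
      then have "card (?top h') < card (?top h)"
        by (intro psubset_card_mono) auto
      moreover have "mdeg \<alpha> \<le> m" if "\<alpha> \<in> Poly_Mapping.keys h'" for \<alpha>
        using that keys_h' r less.prems(1) by blast
      moreover have "rank \<alpha> < Suc n" if "\<alpha> \<in> Poly_Mapping.keys h'" "monomial_poly \<alpha> \<in> J" for \<alpha>
        using that keys_h' r less.prems(2) \<beta> by fastforce
      ultimately obtain h0 where "G_reduces J f h' h0" "normal_form J h0"
        "\<forall>\<alpha>\<in>Poly_Mapping.keys h0. mdeg \<alpha> \<le> m"
        using less.hyps[of h'] by blast
      then show ?thesis
        using step[of h] \<beta> G_step_G_reduces.prepend unfolding h'_def by blast
    qed
  qed
qed

text \<open>This induction mirrors the recursion on degree in the definition of reduction. The bound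
  is strict, so the base case concerns only the zero polynomial.\<close>

lemma reduction_exists_mdeg_bounded:
  "\<lbrakk>\<And>\<alpha>. \<alpha> \<in> Poly_Mapping.keys h \<Longrightarrow> mdeg \<alpha> < m\<rbrakk> \<Longrightarrow>
    \<exists>h0. G_reduces J f h h0 \<and> normal_form J h0 \<and> (\<forall>\<alpha>\<in>Poly_Mapping.keys h0. mdeg \<alpha> < m)"
proof (induction m arbitrary: h)
  case 0
  then have "h = 0"
    by (auto simp flip: keys_eq_empty)
  then show ?case
    using G_step_G_reduces.finished[OF normal_form_zero] normal_form_zero by auto
next
  case (Suc m)
  have rank_le: "rank \<alpha> < Suc (Suc (card (UNIV :: 'x set)))" for \<alpha>
    by (simp add: rank_def less_Suc_eq_le card_mono)
  have replacement: "\<exists>r. (\<forall>h. \<beta> \<in> Poly_Mapping.keys h \<longrightarrow> G_step J f h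
        (h - scale (Poly_Mapping.lookup h \<beta>) (monomial_poly \<beta>) + scale (Poly_Mapping.lookup h \<beta>) r)) \<and>
      (\<forall>\<gamma>\<in>Poly_Mapping.keys r. mdeg \<gamma> \<le> m \<and> (monomial_poly \<gamma> \<in> J \<longrightarrow> rank \<gamma> < rank \<beta>))"
    if "monomial_poly \<beta> \<in> J" "mdeg \<beta> \<le> m" for \<beta>
    by (rule replacement_exists[OF Suc.IH that]) blast+
  show ?case
    using Suc.prems unfolding less_Suc_eq_le
    by (intro reduction_exists_rank_bounded[OF replacement _ rank_le])
qed

lemma reduction_exists: "\<exists>h0. G_reduces J f h h0 \<and> normal_form J h0"
proof -
  have "mdeg \<alpha> < Suc (Max (mdeg ` Poly_Mapping.keys h))" if "\<alpha> \<in> Poly_Mapping.keys h" for \<alpha>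
    using that by (simp add: less_Suc_eq_le)
  then show ?thesis
    using reduction_exists_mdeg_bounded by blast
qed

section \<open>Reductions and normal forms modulo an ideal\<close>

text \<open>A step subtracts a scalar multiple of \<open>f \<beta>\<close> or of a variable times
  \<open>monomial_poly \<delta> - g0\<close>, and the latter difference lies in the ideal by the
  mutual induction. The ideal is left arbitrary in order to cover both the given one and the one
  generated by the \<open>J\<close>-set.\<close>

lemma reduces_diff_in_ideal:
  assumes "ideal.subspace I" "f ` min_gens J \<subseteq> I"
  shows "G_step J f h h' \<Longrightarrow> h - h' \<in> I" and "G_reduces J f h h0 \<Longrightarrow> h - h0 \<in> I"
proof (induction rule: G_step_G_reduces.inducts)
  case (generator \<beta> h)
  let ?c = "Poly_Mapping.lookup h \<beta>"
  have "h - (h - scale ?c (monomial_poly \<beta>) + scale ?c (tail f \<beta>)) = scale ?c (f \<beta>)"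
    by (simp add: tail_def k_linear.scale_right_diff_distrib)
  then show ?case
    using generator assms by (auto intro: ideal_scale)
next
  case (multiple \<beta> h i \<delta> g0)
  let ?c = "Poly_Mapping.lookup h \<beta>"
  have "h - (h - scale ?c (monomial_poly \<beta>) + scale ?c (monomial_poly (var_mon i) * g0)) =
      scale ?c (monomial_poly (var_mon i) * (monomial_poly \<delta> - g0))"
    by (simp add: \<open>\<beta> = var_mon i + \<delta>\<close> monomial_poly_add right_diff_distrib k_linear.scale_right_diff_distrib)
  then show ?case
    using multiple.IH assms(1) by (auto intro!: ideal_scale ideal.subspace_scale)
next
  case (finished h)
  then show ?case
    using assms(1) by (simp add: ideal.subspace_0)
next
  case (prepend h h' h0)
  then have "(h - h') + (h' - h0) \<in> I"
    using assms(1) ideal.subspace_add by blast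
  then show ?case
    by simp
qed

lemma no_step_if_normal_form:
  assumes "normal_form J h"
  shows "\<not> G_step J f h h'"
proof
  assume "G_step J f h h'"
  then show False
  proof cases
    case (generator \<beta>)
    then show False
      using assms by (auto simp: normal_form_def nonmembers_def min_gens_def)
  next
    case (multiple \<beta> i \<delta> g0)
    then show False
      using assms monomial_poly_add_in_ideal(2)[OF subspace_J]
      by (auto simp: normal_form_def nonmembers_def)
  qed
qed

text \<open>Every step acts at a monomial of \<open>J\<close>, so none starts from a normal form.
  This turns a reduction with prescribed result into an equation.\<close>

lemma reduces_normal_form:
  assumes "normal_form J h" "G_reduces J f h h0"
  shows "h0 = h"
  using assms(2) no_step_if_normal_form[OF assms(1)] by cases auto

end
section \<open>Hilbert functions and the equivalences\<close>

lemma subspace_degree_part: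
  assumes "ideal.subspace I"
  shows "k_linear.subspace (degree_part (I :: ('x::finite, 'k::field) mpoly set) m)"
  unfolding k_linear.subspace_def degree_part_def homogeneous_def
proof (safe; simp?)
  show "0 \<in> I"
    using assms by (rule ideal.subspace_0)
next
  fix p q :: "('x, 'k) mpoly"
  assume "p \<in> I" "q \<in> I"
  then show "p + q \<in> I"
    using assms by (intro ideal.subspace_add)
next
  fix p q :: "('x, 'k) mpoly" and \<alpha>
  assume "\<forall>\<alpha>\<in>Poly_Mapping.keys p. mdeg \<alpha> = m" "\<forall>\<alpha>\<in>Poly_Mapping.keys q. mdeg \<alpha> = m"
    "\<alpha> \<in> Poly_Mapping.keys (p + q)"
  then show "mdeg \<alpha> = m"
    using keys_add[of p q] by blast
next
  fix c and p :: "('x, 'k) mpoly"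
  assume "p \<in> I"
  then show "scale c p \<in> I"
    using assms by (rule ideal_scale[rotated])
next
  fix c and p :: "('x, 'k) mpoly" and \<alpha>
  assume "\<forall>\<alpha>\<in>Poly_Mapping.keys p. mdeg \<alpha> = m" "\<alpha> \<in> Poly_Mapping.keys (scale c p)"
  then show "mdeg \<alpha> = m"
    by (auto simp: in_keys_iff)
qed

lemma degree_part_subset_span:
  "degree_part (I :: ('x::finite, 'k::field) mpoly set) m
    \<subseteq> k_linear.span (monomial_poly ` {\<alpha>. mdeg \<alpha> = m})"
  by (auto simp: degree_part_def homogeneous_def in_span_monomial_polys_iff)

locale marked_family_in_ideal = marked_family +
  fixes I :: "('a, 'b) mpoly set"
  assumes homogeneous_ideal: "homogeneous_ideal I"
    and subset_I: "f ` min_gens J \<subseteq> I"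
begin

lemma subspace_I: "ideal.subspace I"
  using homogeneous_ideal by (rule homogeneous_ideal_subspace)

section \<open>Counting dimensions degree by degree\<close>

abbreviation monomials_in :: "nat \<Rightarrow> 'a mon set"
  where "monomials_in m \<equiv> {\<alpha>. monomial_poly \<alpha> \<in> J \<and> mdeg \<alpha> = m}"

abbreviation monomials_out :: "nat \<Rightarrow> 'a mon set"
  where "monomials_out m \<equiv> {\<alpha>. monomial_poly \<alpha> \<notin> J \<and> mdeg \<alpha> = m}"

lemma finite_monomials: "finite (monomials_in m)" "finite (monomials_out m)"
  by (auto intro: finite_subset[OF _ finite_mdeg_eq[of m]])

lemma card_monomials:
  "card {\<alpha> :: 'a mon. mdeg \<alpha> = m} = card (monomials_in m) + card (monomials_out m)"
proof -
  have "{\<alpha> :: 'a mon. mdeg \<alpha> = m} = monomials_in m \<union> monomials_out m"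
    by blast
  then show ?thesis
    using finite_monomials by (simp add: card_Un_disjoint disjoint_iff)
qed

lemma hilbert_dim_J: "hilbert_dim J m = card (monomials_in m)"
  unfolding hilbert_dim_def
proof (rule k_linear.dim_unique[OF _ _ independent_monomial_polys card_monomial_polys])
  show "monomial_poly ` monomials_in m \<subseteq> degree_part J m"
    by (auto simp: degree_part_def homogeneous_def)
  show "degree_part J m \<subseteq> k_linear.span (monomial_poly ` monomials_in m)"
    using in_monomial_ideal_iff[OF monomial_ideal, THEN iffD1]
    by (fastforce simp: degree_part_def homogeneous_def in_span_monomial_polys_iff)
qed

lemma reduces_diff_in_I: "G_reduces J f h h0 \<Longrightarrow> h - h0 \<in> I"
  using reduces_diff_in_ideal[OF subspace_I subset_I] by blast

text \<open>Finiteness comes from the finitely many monomials of degree m, whose span contains the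
  degree part.\<close>

lemma degree_basis:
  obtains B where "B \<subseteq> degree_part I m" "k_linear.independent B"
    "k_linear.span B = degree_part I m" "card B = hilbert_dim I m" "finite B"
proof -
  obtain B where B: "B \<subseteq> degree_part I m" "k_linear.independent B"
    "degree_part I m \<subseteq> k_linear.span B" "card B = k_linear.dim (degree_part I m)"
    by (rule k_linear.basis_exists)
  moreover have "k_linear.span B = degree_part I m"
    using B k_linear.span_minimal[OF _ subspace_degree_part[OF subspace_I]] by blast
  moreover have "finite B"
    using k_linear.independent_span_bound[OF _ B(2), of "monomial_poly ` {\<alpha>. mdeg \<alpha> = m}"]
      B(1) degree_part_subset_span finite_mdeg_eq by blast
  ultimately show ?thesis
    using that by (simp add: hilbert_dim_def)
qed

text \<open>Modulo \<open>I\<close> each monomial equals its complete reduction, so elements of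
  \<open>I\<close> of degree m and the monomials outside \<open>J\<close> together span all
  monomials of degree m, which are independent.\<close>

lemma card_monomials_le_if_spanning:
  assumes "degree_part I m \<subseteq> k_linear.span S" "monomial_poly ` monomials_out m \<subseteq> k_linear.span S"
    and "finite S"
  shows "card {\<alpha> :: 'a mon. mdeg \<alpha> = m} \<le> card S"
proof -
  let ?D = "{\<alpha> :: 'a mon. mdeg \<alpha> = m}"
  have "(monomial_poly \<alpha> :: ('a, 'b) mpoly) \<in> k_linear.span S" if "mdeg \<alpha> = m" for \<alpha>
  proof -
    obtain h0 where h0: "G_reduces J f (monomial_poly \<alpha>) h0" "normal_form J h0"
      using reduction_exists by blast
    \<comment> \<open>\<open>reduction_exists\<close> does not record homogeneity, so the congruence
      is cut down to its component of degree m.\<close>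
    have "part ?D (monomial_poly \<alpha> - h0) \<in> degree_part I m"
      using homogeneous_ideal_part[OF homogeneous_ideal reduces_diff_in_I[OF h0(1)]]
      by (simp add: degree_part_def homogeneous_part)
    moreover have "part ?D h0 \<in> k_linear.span (monomial_poly ` monomials_out m)"
      using h0(2) by (auto simp: in_span_monomial_polys_iff normal_form_def nonmembers_def)
    then have "part ?D h0 \<in> k_linear.span S"
      using k_linear.span_minimal[OF assms(2) k_linear.subspace_span] by blast
    ultimately have "part ?D (monomial_poly \<alpha> - h0) + part ?D h0 \<in> k_linear.span S"
      using assms(1) k_linear.span_add by blast
    moreover have "part ?D (monomial_poly \<alpha>) = (monomial_poly \<alpha> :: ('a, 'b) mpoly)"
      using that by (intro part_id) simp
    ultimately show ?thesis
      by (simp add: part_diff)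
  qed
  then have "monomial_poly ` ?D \<subseteq> k_linear.span S"
    by blast
  then have "card (monomial_poly ` ?D :: ('a, 'b) mpoly set) \<le> card S"
    using k_linear.independent_span_bound[OF assms(3) independent_monomial_polys] by blast
  then show ?thesis
    by (simp only: card_monomial_polys)
qed

lemma hilbert_dim_eq_if_free:
  assumes free: "\<forall>p\<in>I. normal_form J p \<longrightarrow> p = 0"
  shows "hilbert_dim I m = hilbert_dim J m"
proof (rule antisym)
  obtain B where B: "B \<subseteq> degree_part I m" "k_linear.independent B"
    "k_linear.span B = degree_part I m" "card B = hilbert_dim I m" "finite B"
    by (rule degree_basis)
  show "hilbert_dim I m \<le> hilbert_dim J m"
  proof -
    \<comment> \<open>The kernel of this projection on the degree part of \<open>I\<close> consists
      of normal forms in \<open>I\<close>, so it is zero and the basis stays independent in the span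
      of the monomials of \<open>J\<close>.\<close>
    let ?\<pi> = "part (monomials_in m) :: ('a, 'b) mpoly \<Rightarrow> ('a, 'b) mpoly"
    interpret \<pi>: Vector_Spaces.linear scale scale ?\<pi>
      by (rule linear_part)
    have "p = 0" if "p \<in> degree_part I m" "?\<pi> p = 0" for p
    proof -
      have "Poly_Mapping.keys p \<inter> monomials_in m = {}"
        using that(2) by (metis keys_part keys_zero)
      then have "normal_form J p"
        using that(1) by (auto simp: normal_form_def nonmembers_def degree_part_def homogeneous_def)
      then show ?thesis
        using that(1) free by (simp add: degree_part_def)
    qed
    then have inj: "inj_on ?\<pi> (k_linear.span B)"
      using \<pi>.inj_on_iff_eq_0[OF k_linear.subspace_span] B(3) by blast
    then have "card B = card (?\<pi> ` B)"
      by (rule card_image[OF inj_on_subset[OF _ k_linear.span_superset], symmetric])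
    also have "\<dots> \<le> card (monomial_poly ` monomials_in m :: ('a, 'b) mpoly set)"
    proof -
      have "?\<pi> ` B \<subseteq> k_linear.span (monomial_poly ` monomials_in m)"
        by (auto simp: in_span_monomial_polys_iff)
      then show ?thesis
        using k_linear.independent_span_bound[OF _ \<pi>.independent_injective_image[OF B(2) inj]]
          finite_monomials by blast
    qed
    finally show ?thesis
      by (simp add: B(4) hilbert_dim_J card_monomial_polys)
  qed
  show "hilbert_dim J m \<le> hilbert_dim I m"
  proof -
    \<comment> \<open>This set spans degree m, so its size bounds the number of all monomials;
      cancelling those outside \<open>J\<close> gives the inequality.\<close>
    let ?S = "B \<union> monomial_poly ` monomials_out m"
    have "card {\<alpha> :: 'a mon. mdeg \<alpha> = m} \<le> card ?S"
      using B(5) finite_monomials k_linear.span_mono[of B ?S] k_linear.span_superset[of ?S]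
      by (intro card_monomials_le_if_spanning) (auto simp flip: B(3))
    also have "\<dots> \<le> card B + card (monomial_poly ` monomials_out m :: ('a, 'b) mpoly set)"
      by (rule card_Un_le)
    finally show ?thesis
      by (simp add: B(4) hilbert_dim_J card_monomial_polys card_monomials)
  qed
qed

text \<open>
  A nonzero normal form in \<open>I\<close> makes one monomial outside \<open>J\<close> redundant in the spanning set
  formed by a basis of \<open>I\<^sub>m\<close> and the monomials of degree \<open>m\<close> outside \<open>J\<close>.
\<close>

lemma free_if_hilbert_dim_le:
  assumes le: "\<forall>m. hilbert_dim I m \<le> hilbert_dim J m"
    and p: "p \<in> I" "normal_form J p"
  shows "p = 0"
proof (rule ccontr)
  assume "p \<noteq> 0"
  then have "Poly_Mapping.keys p \<noteq> {}"
    by simp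
  then obtain \<alpha> where \<alpha>: "\<alpha> \<in> Poly_Mapping.keys p"
    by blast
  \<comment> \<open>Taking the degree of a monomial that occurs in \<open>p\<close> makes the
    component \<open>q\<close> nonzero.\<close>
  define m where "m = mdeg \<alpha>"
  define q where "q = part {\<alpha>. mdeg \<alpha> = m} p"
  have q: "q \<in> degree_part I m" "\<alpha> \<in> Poly_Mapping.keys q" "Poly_Mapping.keys q \<subseteq> monomials_out m"
    using homogeneous_ideal_part[OF homogeneous_ideal p(1)] \<alpha> p(2)
    by (auto simp: q_def degree_part_def homogeneous_part m_def normal_form_def nonmembers_def)
  obtain B where B: "B \<subseteq> degree_part I m" "k_linear.independent B"
    "k_linear.span B = degree_part I m" "card B = hilbert_dim I m" "finite B"
    by (rule degree_basis)
  let ?N = "monomial_poly ` (monomials_out m - {\<alpha>}) :: ('a, 'b) mpoly set"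
  let ?S = "B \<union> ?N"
  have span_B: "degree_part I m \<subseteq> k_linear.span ?S"
    using k_linear.span_mono[of B ?S] B(3) by blast
  have span_N: "k_linear.span ?N \<subseteq> k_linear.span ?S"
    by (rule k_linear.span_mono) blast
  let ?c = "Poly_Mapping.lookup q \<alpha>"
  have "?c \<noteq> 0"
    using q(2) by (simp add: in_keys_iff)
  have "q - scale ?c (monomial_poly \<alpha>) \<in> k_linear.span ?N"
    using q(3) by (auto simp: in_span_monomial_polys_iff in_keys_iff lookup_minus split: if_splits)
  then have "q - (q - scale ?c (monomial_poly \<alpha>)) \<in> k_linear.span ?S"
    using q(1) span_B span_N by (blast intro: k_linear.span_diff)
  then have "scale ?c (monomial_poly \<alpha>) \<in> k_linear.span ?S"
    by simp
  from k_linear.span_scale[OF this, of "inverse ?c"]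
  have "monomial_poly \<alpha> \<in> k_linear.span ?S"
    using \<open>?c \<noteq> 0\<close> by simp
  moreover have "?N \<subseteq> k_linear.span ?S"
    using k_linear.span_superset[of ?S] by blast
  ultimately have "monomial_poly ` monomials_out m \<subseteq> k_linear.span ?S"
    by blast
  then have "card {\<alpha> :: 'a mon. mdeg \<alpha> = m} \<le> card ?S"
    using span_B B(5) finite_monomials by (intro card_monomials_le_if_spanning) auto
  also have "\<dots> \<le> card B + card ?N"
    by (rule card_Un_le)
  also have "card ?N < card (monomials_out m)"
    unfolding card_monomial_polys
    using q finite_monomials by (intro psubset_card_mono) auto
  finally show False
    using le[rule_format, of m] by (simp add: B(4) hilbert_dim_J card_monomials)
qed

section \<open>The conditions as absence of nonzero normal forms\<close>

lemma free_mod_nonmembers_iff: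
  assumes "ideal.subspace K"
  shows "free_mod (nonmembers J) K \<longleftrightarrow> (\<forall>p\<in>K. normal_form J p \<longrightarrow> p = 0)"
  unfolding free_mod_iff[OF assms] normal_form_def ..

lemma spans_mod_nonmembers:
  assumes "ideal.subspace K" "f ` min_gens J \<subseteq> K"
  shows "spans_mod (nonmembers J) K"
  using assms(1)
proof (rule spans_modI)
  fix h
  show "\<exists>h0. Poly_Mapping.keys h0 \<subseteq> nonmembers J \<and> h - h0 \<in> K"
    using reduction_exists[of h] reduces_diff_in_ideal(2)[OF assms]
    by (auto simp: normal_form_def)
qed

lemma BSt_iff_free: "I \<in> BSt J \<longleftrightarrow> (\<forall>p\<in>I. normal_form J p \<longrightarrow> p = 0)"
  using homogeneous_ideal spans_mod_nonmembers[OF subspace_I subset_I]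
    free_mod_nonmembers_iff[OF subspace_I]
  unfolding BSt_def basis_mod_def by blast

text \<open>For the converse, an element of \<open>I\<close> is congruent to its complete reduction
  already modulo the ideal generated by the \<open>J\<close>-set. That reduction is a normal form in
  \<open>I\<close>, hence zero, so the \<open>J\<close>-set generates \<open>I\<close>.\<close>

lemma J_basis_iff_free: "J_basis J (f ` min_gens J) I \<longleftrightarrow> (\<forall>p\<in>I. normal_form J p \<longrightarrow> p = 0)"
proof
  assume "J_basis J (f ` min_gens J) I"
  then have "free_mod (nonmembers J) I"
    unfolding J_basis_def basis_mod_def by metis
  then show "\<forall>p\<in>I. normal_form J p \<longrightarrow> p = 0"
    by (simp only: free_mod_nonmembers_iff[OF subspace_I])
next
  let ?K = "ideal.span (f ` min_gens J)"
  assume free: "\<forall>p\<in>I. normal_form J p \<longrightarrow> p = 0"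
  have "?K \<subseteq> I"
    using subset_I subspace_I by (rule ideal.span_minimal)
  moreover have "h \<in> ?K" if "h \<in> I" for h
  proof -
    obtain h0 where h0: "G_reduces J f h h0" "normal_form J h0"
      using reduction_exists by blast
    then have "h - h0 \<in> ?K"
      using reduces_diff_in_ideal(2)[OF ideal.subspace_span ideal.span_superset] by blast
    then have "h - (h - h0) \<in> I"
      using \<open>?K \<subseteq> I\<close> \<open>h \<in> I\<close> by (blast intro: ideal.subspace_diff[OF subspace_I])
    then have "h0 = 0"
      using free h0(2) by simp
    then show ?thesis
      using \<open>h - h0 \<in> ?K\<close> by simp
  qed
  ultimately have "?K = I"
    by blast
  then show "J_basis J (f ` min_gens J) I"
    using free spans_mod_nonmembers[OF subspace_I subset_I]
    unfolding J_basis_def basis_mod_def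
    by (simp only: free_mod_nonmembers_iff[OF subspace_I] simp_thms)
qed

text \<open>Two normal forms of \<open>h\<close> modulo \<open>I\<close> differ by a normal form in
  \<open>I\<close>, so the result of any complete reduction of \<open>h\<close> must be
  \<open>h0\<close>.\<close>

lemma reduces_if_normal_form_mod:
  assumes free: "\<forall>p\<in>I. normal_form J p \<longrightarrow> p = 0" and "normal_form_mod J I h h0"
  shows "G_reduces J f h h0"
proof -
  have h0: "normal_form J h0" "h - h0 \<in> I"
    using assms(2) by (simp_all add: normal_form_mod_def)
  obtain h1 where h1: "G_reduces J f h h1" "normal_form J h1"
    using reduction_exists by blast
  then have "(h - h1) - (h - h0) \<in> I"
    using reduces_diff_in_I h0(2) by (blast intro: ideal.subspace_diff[OF subspace_I])
  then have "h0 - h1 \<in> I"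
    by simp
  then have "h0 - h1 = 0"
    using free normal_form_diff[OF h0(1) h1(2)] by blast
  then show ?thesis
    using h1(1) by simp
qed

text \<open>Zero is a normal form modulo \<open>I\<close> of each element of \<open>I\<close>;
  conversely a normal form reduces only to itself, so reducing to zero makes it zero.\<close>

lemma free_iff_reduces_to_0:
  "(\<forall>p\<in>I. normal_form J p \<longrightarrow> p = 0) \<longleftrightarrow> (\<forall>h\<in>I. G_reduces J f h 0)"
  using reduces_if_normal_form_mod[of _ 0] reduces_normal_form normal_form_zero
  by (fastforce simp: normal_form_mod_def)

text \<open>
  If \<open>p \<in> I\<close> is a normal form containing \<open>X\<^sup>\<beta>\<close>, then \<open>X\<^sup>\<beta>\<close> is irreducible, but \<open>X\<^sup>\<beta> - p\<close> is another
  normal form of \<open>X\<^sup>\<beta>\<close> modulo \<open>I\<close>.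
\<close>

lemma free_if_monomials_reduce:
  assumes "\<forall>\<beta> h0. normal_form_mod J I (monomial_poly \<beta>) h0 \<longrightarrow> G_reduces J f (monomial_poly \<beta>) h0"
    and p: "p \<in> I" "normal_form J p"
  shows "p = 0"
proof (rule ccontr)
  assume "p \<noteq> 0"
  then have "Poly_Mapping.keys p \<noteq> {}"
    by simp
  then obtain \<beta> where "\<beta> \<in> Poly_Mapping.keys p"
    by blast
  then have \<beta>: "normal_form J (monomial_poly \<beta>)"
    using p(2) by (auto simp: normal_form_def)
  then have "normal_form_mod J I (monomial_poly \<beta>) (monomial_poly \<beta> - p)"
    using p normal_form_diff by (simp add: normal_form_mod_def)
  then have "monomial_poly \<beta> - p = monomial_poly \<beta>"
    using assms(1) reduces_normal_form[OF \<beta>] by blast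
  then show False
    using \<open>p \<noteq> 0\<close> by simp
qed

end

theorem corollary12:
  fixes J I :: "('x::{finite,linorder}, 'k::alg_closed_field) mpoly set"
    and f :: "'x mon \<Rightarrow> ('x, 'k) mpoly"
    and G :: "('x, 'k) mpoly set"
  assumes "strongly_stable J"
    and "homogeneous_ideal I"
    and "J_set J f"
    and "G = f ` min_gens J"
    and "G \<subseteq> I"
  shows "(I \<in> BSt J \<longleftrightarrow> J_basis J G I)
       \<and> (I \<in> BSt J \<longleftrightarrow> free_mod (nonmembers J) I)
       \<and> (I \<in> BSt J \<longleftrightarrow> (\<forall>m. hilbert_dim I m = hilbert_dim J m))
       \<and> (I \<in> BSt J \<longleftrightarrow> (\<forall>m. hilbert_dim I m \<le> hilbert_dim J m))
       \<and> (I \<in> BSt J \<longleftrightarrow> (\<forall>h\<in>I. G_reduces J f h 0))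
       \<and> (I \<in> BSt J \<longleftrightarrow> (\<forall>h h0. normal_form_mod J I h h0 \<longrightarrow> G_reduces J f h h0))
       \<and> (I \<in> BSt J \<longleftrightarrow>
            (\<forall>\<beta> h0. normal_form_mod J I (monomial_poly \<beta>) h0 \<longrightarrow> G_reduces J f (monomial_poly \<beta>) h0))"
proof -
  interpret marked_family_in_ideal J f I
    using assms by unfold_locales simp_all
  let ?free = "\<forall>p\<in>I. normal_form J p \<longrightarrow> p = 0"
  have "?free \<longleftrightarrow> (\<forall>m. hilbert_dim I m = hilbert_dim J m)"
    using hilbert_dim_eq_if_free free_if_hilbert_dim_le by (metis order_refl)
  moreover have "?free \<longleftrightarrow> (\<forall>m. hilbert_dim I m \<le> hilbert_dim J m)"
    using hilbert_dim_eq_if_free free_if_hilbert_dim_le by (metis order_refl)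
  \<comment> \<open>The way back specializes to monomials, where an alternative normal form already
    rules out nonzero normal forms in \<open>I\<close>.\<close>
  moreover have "?free \<longleftrightarrow> (\<forall>h h0. normal_form_mod J I h h0 \<longrightarrow> G_reduces J f h h0)"
    using reduces_if_normal_form_mod free_if_monomials_reduce by blast
  moreover have "?free \<longleftrightarrow>
      (\<forall>\<beta> h0. normal_form_mod J I (monomial_poly \<beta>) h0 \<longrightarrow> G_reduces J f (monomial_poly \<beta>) h0)"
    using reduces_if_normal_form_mod free_if_monomials_reduce by blast
  ultimately show ?thesis
    using J_basis_iff_free free_mod_nonmembers_iff[OF subspace_I] free_iff_reduces_to_0
    unfolding BSt_iff_free assms(4) by blast
qed

end
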